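(* For every integer $m\ge 3$, \[ \gamma_{oiR}(P_{2}\Box C_{m})=\begin{cases}\lceil \frac{4m}{3}\rceil+1, & m\equiv 3 \text{ or } 5 \pmod 6,\\[2pt] \lceil \frac{4m}{3}\rceil, & \text{otherwise.}\end{cases} \]
   Context: All graphs are simple and undirected. $P_n$ denotes the path on $n$ vertices and $C_m$ the cycle on $m$ vertices; $P_n\Box C_m$ is their Cartesian product, with vertex set $\{v_{i,j}: 0\le i\le n-1,\ 0\le j\le m-1\}$, where $v_{i,j}$ and $v_{i',j'}$ are adjacent iff either $i=i'$ and $j'\equiv j\pm1 \pmod m$, or $j=j'$ and $|i-i'|=1$. For a graph $G=(V,E)$, an outer independent Roman dominating function (OIRDF) is a function $f:V\to\{0,1,2\}$ such that every vertex $u$ with $f(u)=0$ has a neighbour $v$ with $f(v)=2$, and the set $V_0=\{u\in V: f(u)=0\}$ is an independent set (no two vertices with label $0$ are adjacent). The weight of $f$ is $w(f)=\sum_{v\in V}f(v)$, and the outer independent Roman domination number $\gamma_{oiR}(G)$ is the minimum weight of an OIRDF of $G$. *)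

theory Defs
  imports Complex_Main "HOL-Number_Theory.Cong"
begin

text \<open>A graph is a pair of a vertex set and an adjacency predicate; only the values of the
  predicate on the vertex set matter.\<close>

type_synonym 'a graph = "'a set \<times> ('a \<Rightarrow> 'a \<Rightarrow> bool)"

abbreviation verts :: "'a graph \<Rightarrow> 'a set" where
  "verts G \<equiv> fst G"

abbreviation adj :: "'a graph \<Rightarrow> 'a \<Rightarrow> 'a \<Rightarrow> bool" where
  "adj G \<equiv> snd G"

definition simple_graph :: "'a graph \<Rightarrow> bool" where
  "simple_graph G \<longleftrightarrow>
     (\<forall>u\<in>verts G. \<not> adj G u u) \<and>
     (\<forall>u\<in>verts G. \<forall>v\<in>verts G. adj G u v \<longrightarrow> adj G v u)"

definition path_graph :: "nat \<Rightarrow> nat graph" where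
  "path_graph n = ({0..<n}, \<lambda>i i'. \<bar>int i - int i'\<bar> = 1)"

text \<open>The cycle is a simple graph with \<open>m\<close> edges only for \<open>m \<ge> 3\<close>.\<close>

definition cycle_graph :: "nat \<Rightarrow> nat graph" where
  "cycle_graph m =
     ({0..<m}, \<lambda>j j'. [int j' = int j + 1] (mod int m) \<or> [int j' = int j - 1] (mod int m))"

definition cartesian_product :: "'a graph \<Rightarrow> 'b graph \<Rightarrow> ('a \<times> 'b) graph" (infixr "\<box>" 70) where
  "G \<box> H =
     (verts G \<times> verts H,
      \<lambda>(u, x) (v, y). (u = v \<and> adj H x y) \<or> (x = y \<and> adj G u v))"

definition independent_set :: "'a graph \<Rightarrow> 'a set \<Rightarrow> bool" where
  "independent_set G S \<longleftrightarrow> S \<subseteq> verts G \<and> (\<forall>u\<in>S. \<forall>v\<in>S. \<not> adj G u v)"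

definition oirdf :: "'a graph \<Rightarrow> ('a \<Rightarrow> nat) \<Rightarrow> bool" where
  "oirdf G f \<longleftrightarrow>
     (\<forall>v\<in>verts G. f v \<in> {0, 1, 2}) \<and>
     (\<forall>u\<in>verts G. f u = 0 \<longrightarrow> (\<exists>v\<in>verts G. adj G u v \<and> f v = 2)) \<and>
     independent_set G {u \<in> verts G. f u = 0}"

definition weight :: "'a graph \<Rightarrow> ('a \<Rightarrow> nat) \<Rightarrow> nat" where
  "weight G f = (\<Sum>v\<in>verts G. f v)"

definition oiR_domination_number :: "'a graph \<Rightarrow> nat" ("\<gamma>\<^sub>o\<^sub>i\<^sub>R") where
  "\<gamma>\<^sub>o\<^sub>i\<^sub>R G = (LEAST w. \<exists>f. oirdf G f \<and> weight G f = w)"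

text \<open>The constant function 1 is an OIRDF, so the minimum above is attained.\<close>

lemma oiR_domination_number_attained:
  "\<exists>f. oirdf G f \<and> weight G f = \<gamma>\<^sub>o\<^sub>i\<^sub>R G"
proof -
  have "oirdf G (\<lambda>_. 1)"
    by (simp add: oirdf_def independent_set_def)
  then have "\<exists>w f. oirdf G f \<and> weight G f = w"
    by blast
  then show ?thesis
    unfolding oiR_domination_number_def by (rule LeastI_ex)
qed

lemma oiR_domination_number_le:
  "oirdf G f \<Longrightarrow> \<gamma>\<^sub>o\<^sub>i\<^sub>R G \<le> weight G f"
  unfolding oiR_domination_number_def by (rule Least_le) blast

lemma verts_path_cycle:
  "verts (path_graph n \<box> cycle_graph m) = {0..<n} \<times> {0..<m}"
  by (simp add: cartesian_product_def path_graph_def cycle_graph_def)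

lemma adj_path_cycle:
  "adj (path_graph n \<box> cycle_graph m) (i, j) (i', j') \<longleftrightarrow>
     (i = i' \<and> ([int j' = int j + 1] (mod int m) \<or> [int j' = int j - 1] (mod int m))) \<or>
     (j = j' \<and> \<bar>int i - int i'\<bar> = 1)"
  by (simp add: cartesian_product_def path_graph_def cycle_graph_def)

lemma simple_path_cycle:
  assumes "m \<ge> 2"
  shows "simple_graph (path_graph n \<box> cycle_graph m)"
proof -
  have "\<not> int m dvd 1"
    using assms by simp
  then have "\<not> [int j = int j + 1] (mod int m)" "\<not> [int j = int j - 1] (mod int m)" for j
    by (simp_all add: cong_iff_dvd_diff)
  moreover have "[int j = int j' - 1] (mod int m)" if "[int j' = int j + 1] (mod int m)" for j j'
    using that by (metis add_diff_cancel_right' cong_diff cong_refl cong_sym)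
  moreover have "[int j = int j' + 1] (mod int m)" if "[int j' = int j - 1] (mod int m)" for j j'
    using that by (metis diff_add_cancel cong_add cong_refl cong_sym)
  ultimately show ?thesis
    unfolding simple_graph_def by (auto simp: adj_path_cycle abs_minus_commute)
qed

end

theory Submission imports Defs begin

text \<open>
  Lower bound: let \<open>z\<close> and \<open>t\<close> be the numbers of vertices labelled 0 and 2, so the weight is
  \<open>2m - z + t\<close>. A vertex has only three neighbours, so \<open>z \<le> 3t\<close>. Independence allows at
  most one 0 per column, so \<open>z \<le> m\<close>; if \<open>z = m\<close>, then the zeros alternate between the two
  rows around the cycle, so \<open>m\<close> is even.

  Upper bound: put 0 on the odd vertices of the checkerboard and, on the even ones, 2 in the
  columns congruent to 1 modulo 3 and 1 elsewhere. Unless \<open>m\<close> is 0 or 2 modulo 6, the 0 in the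
  last column violates a condition at the seam and is raised to 1.
\<close>

section \<open>Adjacency in the prism\<close>

abbreviation prism :: "nat \<Rightarrow> (nat \<times> nat) graph" where
  "prism m \<equiv> path_graph 2 \<box> cycle_graph m"

lemma adj_prism_Suc: "adj (prism m) (i, j) (i, Suc j)"
  unfolding adj_path_cycle by (simp add: add.commute)

lemma adj_prism_wrap:
  assumes "m > 0"
  shows "adj (prism m) (i, m - 1) (i, 0)"
  using assms unfolding adj_path_cycle by (simp add: cong_def of_nat_diff)

text \<open>For indices below \<open>m\<close>, a congruence between one index and the successor of
  another is an equality unless the successor is \<open>m\<close>, which reduces to 0; this gives
  the two wrap-around cases.\<close>

lemma cycle_graph_neighbours:
  assumes "j < m" "j' < m"
    and "[int j' = int j + 1] (mod int m) \<or> [int j' = int j - 1] (mod int m)"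
  shows "j' = Suc j \<or> j = Suc j' \<or> (j = 0 \<and> j' = m - 1) \<or> (j' = 0 \<and> j = m - 1)"
  using assms(3)
proof
  assume "[int j' = int j + 1] (mod int m)"
  then have "int j' mod int m = int (Suc j) mod int m"
    by (simp add: cong_def add.commute)
  then have "j' mod m = Suc j mod m"
    by (metis of_nat_mod of_nat_eq_iff)
  then show ?thesis
    using assms(1,2) by (cases "Suc j = m") auto
next
  assume "[int j' = int j - 1] (mod int m)"
  then have "[int j' + 1 = int j] (mod int m)"
    by (metis cong_add cong_refl diff_add_cancel)
  then have "int (Suc j') mod int m = int j mod int m"
    by (simp add: cong_def add.commute)
  then have "Suc j' mod m = j mod m"
    by (metis of_nat_mod of_nat_eq_iff)
  then show ?thesis
    using assms(1,2) by (cases "Suc j' = m") auto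
qed

lemma card_prism_neighbours_le:
  assumes "v \<in> verts (prism m)"
  shows "card {u \<in> verts (prism m). adj (prism m) u v} \<le> 3"
proof -
  obtain i j where v: "v = (i, j)" "i < 2" "j < m"
    using assms by (auto simp: verts_path_cycle)
  \<comment> \<open>\<open>1 - i\<close> swaps the rows 0 and 1. Adding \<open>m\<close> before
    subtracting 1 avoids truncation at \<open>j = 0\<close>, where the predecessor is
    \<open>m - 1\<close>.\<close>
  let ?N = "{(1 - i, j), (i, Suc j mod m), (i, (j + m - 1) mod m)}"
  have "{u \<in> verts (prism m). adj (prism m) u v} \<subseteq> ?N"
  proof
    fix u assume "u \<in> {u \<in> verts (prism m). adj (prism m) u v}"
    then obtain i' j' where u: "u = (i', j')" "i' < 2" "j' < m"
      and a: "adj (prism m) (i', j') (i, j)"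
      by (auto simp: verts_path_cycle v)
    from a consider "i' = i"
        "[int j = int j' + 1] (mod int m) \<or> [int j = int j' - 1] (mod int m)"
      | "j' = j" "\<bar>int i' - int i\<bar> = 1"
      unfolding adj_path_cycle by blast
    then show "u \<in> ?N"
    proof cases
      case 1
      then consider "j = Suc j'" | "j' = Suc j" | "j' = 0" "j = m - 1" | "j = 0" "j' = m - 1"
        using cycle_graph_neighbours[OF u(3) v(3)] by blast
      then show ?thesis
        using 1(1) u v by cases auto
    next
      case 2
      then have "i' = 1 - i"
        using u v by auto
      with 2 u show ?thesis by simp
    qed
  qed
  then have "card {u \<in> verts (prism m). adj (prism m) u v} \<le> card ?N"
    by (intro card_mono) auto
  also have "\<dots> \<le> 3"
    by (simp add: card_insert_if)
  finally show ?thesis .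
qed

section \<open>Lower bound by counting zeros and twos\<close>

context
  fixes m :: nat and f :: "nat \<times> nat \<Rightarrow> nat" and Z T :: "(nat \<times> nat) set"
  assumes f: "oirdf (prism m) f" and m: "m \<ge> 3"
  defines "Z \<equiv> {v \<in> verts (prism m). f v = 0}"
    and "T \<equiv> {v \<in> verts (prism m). f v = 2}"
begin

lemma finite_twos: "finite T"
  unfolding T_def by (simp add: verts_path_cycle)

lemma zeros_not_adj: "u \<in> Z \<Longrightarrow> v \<in> Z \<Longrightarrow> \<not> adj (prism m) u v"
  using f unfolding oirdf_def independent_set_def Z_def by blast

text \<open>Each label differs from 1 by a deficit of 1 at a zero and an excess of 1 at a two; sum
  this over the \<open>2 * m\<close> vertices.\<close>

lemma weight_plus_card_zeros: "weight (prism m) f + card Z = 2 * m + card T"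
proof -
  let ?V = "verts (prism m)"
  have fin: "finite ?V" by (simp add: verts_path_cycle)
  have "f v + of_bool (f v = 0) = 1 + of_bool (f v = 2)" if "v \<in> ?V" for v
    using f that unfolding oirdf_def by fastforce
  then have "(\<Sum>v\<in>?V. f v + of_bool (f v = 0)) = (\<Sum>v\<in>?V. 1 + of_bool (f v = 2))"
    by (intro sum.cong) auto
  moreover have "(\<Sum>v\<in>?V. of_bool (f v = k)) = card {v \<in> ?V. f v = k}" for k
    using fin by (simp add: of_bool_def sum.If_cases Int_def)
  ultimately have "(\<Sum>v\<in>?V. f v) + card Z = (\<Sum>v\<in>?V. 1) + card T"
    unfolding sum.distrib Z_def T_def by (simp only:)
  then show ?thesis
    by (simp add: weight_def verts_path_cycle)
qed

lemma card_zeros_le_twos: "card Z \<le> 3 * card T"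
proof -
  have "Z \<subseteq> (\<Union>v\<in>T. {u \<in> verts (prism m). adj (prism m) u v})"
    using f unfolding oirdf_def Z_def T_def by blast
  then have "card Z \<le> card (\<Union>v\<in>T. {u \<in> verts (prism m). adj (prism m) u v})"
    by (intro card_mono finite_UN_I finite_twos) (simp_all add: verts_path_cycle)
  also have "\<dots> \<le> (\<Sum>v\<in>T. card {u \<in> verts (prism m). adj (prism m) u v})"
    by (rule card_UN_le[OF finite_twos])
  also have "\<dots> \<le> (\<Sum>v\<in>T. 3)"
    by (intro sum_mono card_prism_neighbours_le) (simp add: T_def)
  finally show ?thesis by simp
qed

text \<open>The two vertices of a column are adjacent, so \<open>card Z\<close> counts the columns
  that contain a zero.\<close>

lemma inj_on_snd_zeros: "inj_on snd Z"
proof (rule inj_onI)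
  fix u v assume uv: "u \<in> Z" "v \<in> Z" "snd u = snd v"
  then obtain i i' j where "u = (i, j)" "v = (i', j)" "i < 2" "i' < 2"
    unfolding Z_def verts_path_cycle by fastforce
  moreover have "\<not> adj (prism m) u v"
    using uv zeros_not_adj by blast
  ultimately show "u = v"
    unfolding adj_path_cycle by (auto simp: less_2_cases_iff adj_path_cycle)
qed

lemma snd_zeros_subset: "snd ` Z \<subseteq> {0..<m}"
  unfolding Z_def verts_path_cycle by auto

lemma card_zeros_le: "card Z \<le> m"
  using card_mono[OF _ snd_zeros_subset] card_image[OF inj_on_snd_zeros] by simp

lemma even_if_card_zeros_eq:
  assumes "card Z = m"
  shows "even m"
proof -
  have "snd ` Z = {0..<m}"
    using assms card_image[OF inj_on_snd_zeros] snd_zeros_subset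
    by (intro card_subset_eq) auto
  then have "\<forall>j\<in>{0..<m}. \<exists>i. (i, j) \<in> Z"
    by (metis imageE prod.collapse)
  \<comment> \<open>\<open>r j\<close> is the row of the zero in column \<open>j\<close>.\<close>
  then obtain r where r: "\<And>j. j < m \<Longrightarrow> (r j, j) \<in> Z"
    by (metis atLeastLessThan_iff zero_le)
  have r2: "r j < 2" if "j < m" for j
    using r[OF that] unfolding Z_def verts_path_cycle by simp
  have alternate: "even (r j + r 0) \<longleftrightarrow> even j" if "j < m" for j
    using that
  proof (induction j)
    case 0
    show ?case by simp
  next
    case (Suc j)
    have "r j \<noteq> r (Suc j)"
      using zeros_not_adj[OF r r, of j "Suc j"] adj_prism_Suc Suc.prems by auto
    then have "even (r (Suc j) + r 0) \<longleftrightarrow> odd (r j + r 0)"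
      using r2[of j] r2[of "Suc j"] Suc.prems by (auto simp: less_2_cases_iff)
    then show ?case using Suc by auto
  qed
  \<comment> \<open>The edge that closes the cycle forces one more change of row, so
    \<open>m - 1\<close> is odd.\<close>
  have "r (m - 1) \<noteq> r 0"
    using zeros_not_adj[OF r r, of "m - 1" 0] adj_prism_wrap m by auto
  then have "odd (r (m - 1) + r 0)"
    using r2[of "m - 1"] r2[of 0] m by (auto simp: less_2_cases_iff)
  then show ?thesis
    using alternate[of "m - 1"] m by simp
qed

text \<open>With \<open>z\<close> zeros and \<open>t\<close> twos, three times the weight is
  \<open>6m - 3z + 3t\<close>, hence at least \<open>6m - 2z\<close>; then \<open>z\<close> is at
  most \<open>m\<close>, or \<open>m - 1\<close> for odd \<open>m\<close>.\<close>

lemma weight_lower_bound: "3 * weight (prism m) f \<ge> 4 * m + (if odd m then 2 else 0)"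
proof -
  have "card Z + (if odd m then 1 else 0) \<le> m"
    using card_zeros_le even_if_card_zeros_eq by (cases "card Z = m") auto
  then show ?thesis
    using weight_plus_card_zeros card_zeros_le_twos by (auto split: if_splits)
qed

end

section \<open>Upper bound by a checkerboard labelling\<close>

definition seam :: "nat \<Rightarrow> bool" where
  "seam m \<longleftrightarrow> odd m \<or> m mod 3 = 1"

text \<open>The two disjuncts of \<open>seam\<close> are the two possible failures of a 0 in column
  \<open>m - 1\<close>: for odd \<open>m\<close> it is adjacent to the 0 of column 0, and for
  \<open>m mod 3 = 1\<close> the 2 expected in the next column is missing, as that column is column
  0.\<close>

definition checkerboard :: "nat \<Rightarrow> nat \<times> nat \<Rightarrow> nat" where
  "checkerboard m = (\<lambda>(i, j).
     if odd (i + j) then of_bool (j = m - 1 \<and> seam m) else if j mod 3 = 1 then 2 else 1)"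

lemma oirdf_checkerboard:
  assumes m: "m \<ge> 3"
  shows "oirdf (prism m) (checkerboard m)"
  unfolding oirdf_def independent_set_def
proof (intro conjI ballI impI)
  fix v assume "v \<in> verts (prism m)"
  show "checkerboard m v \<in> {0, 1, 2}"
    by (cases v) (simp add: checkerboard_def)
next
  fix u assume "u \<in> verts (prism m)" and zero: "checkerboard m u = 0"
  then obtain i j where u: "u = (i, j)" "i < 2" "j < m"
    by (auto simp: verts_path_cycle)
  have odd: "odd (i + j)" and last: "\<not> (j = m - 1 \<and> seam m)"
    using zero by (auto simp: checkerboard_def u split: if_splits)
  \<comment> \<open>The column labelled 2 is the next one, the same one or the previous one,
    according to the residue of \<open>j\<close>.\<close>
  consider "j mod 3 = 0" | "j mod 3 = 1" | "j mod 3 = 2"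
    by linarith
  then show "\<exists>v\<in>verts (prism m). adj (prism m) u v \<and> checkerboard m v = 2"
  proof cases
    case 1
    then have "Suc j mod 3 = 1" by presburger
    \<comment> \<open>If \<open>Suc j = m\<close>, then \<open>m mod 3 = 1\<close>, so this last
      vertex would have been raised to 1.\<close>
    moreover have "Suc j < m"
      using last u(3) \<open>Suc j mod 3 = 1\<close> unfolding seam_def by (cases "Suc j = m") auto
    ultimately show ?thesis
      using odd u adj_prism_Suc
      by (intro bexI[of _ "(i, Suc j)"]) (auto simp: checkerboard_def verts_path_cycle)
  next
    case 2
    then show ?thesis
      using odd u
      by (intro bexI[of _ "(1 - i, j)"])
        (auto simp: checkerboard_def verts_path_cycle adj_path_cycle less_2_cases_iff)
  next
    case 3
    then obtain k where k: "j = Suc k" by (cases j) auto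
    with 3 have "k mod 3 = 1"
      by (simp add: mod_Suc split: if_splits)
    then show ?thesis
      using odd u k
      by (intro bexI[of _ "(i, k)"])
        (auto simp: checkerboard_def verts_path_cycle adj_path_cycle)
  qed
next
  show "{u \<in> verts (prism m). checkerboard m u = 0} \<subseteq> verts (prism m)" by blast
next
  fix u v
  assume "u \<in> {u \<in> verts (prism m). checkerboard m u = 0}"
    and "v \<in> {u \<in> verts (prism m). checkerboard m u = 0}"
  then obtain i j i' j' where uv: "u = (i, j)" "v = (i', j')" "i < 2" "j < m" "i' < 2" "j' < m"
    and zero: "checkerboard m (i, j) = 0" "checkerboard m (i', j') = 0"
    by (auto simp: verts_path_cycle)
  have odd: "odd (i + j)" "odd (i' + j')"
    and last: "\<not> (j = m - 1 \<and> seam m)" "\<not> (j' = m - 1 \<and> seam m)"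
    using zero by (auto simp: checkerboard_def split: if_splits)
  show "\<not> adj (prism m) u v"
  proof
    assume "adj (prism m) u v"
    then consider "i = i'"
        "[int j' = int j + 1] (mod int m) \<or> [int j' = int j - 1] (mod int m)"
      | "j = j'" "\<bar>int i - int i'\<bar> = 1"
      unfolding uv adj_path_cycle by blast
    then show False
    proof cases
      case 1
      \<comment> \<open>Zeros in one row have columns of equal parity. This excludes consecutive
        columns, and across the seam it makes \<open>m\<close> odd, so that the last zero was
        raised.\<close>
      have parity: "even j \<longleftrightarrow> even j'"
        using odd 1(1) by auto
      consider "j' = Suc j" | "j = Suc j'" | "j = 0" "j' = m - 1" | "j' = 0" "j = m - 1"
        using cycle_graph_neighbours[OF uv(4,6) 1(2)] by blast
      then show False
        using parity last m by cases (auto simp: seam_def)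
    next
      case 2
      then show False
        using odd uv by (auto simp: less_2_cases_iff)
    qed
  qed
qed

lemma card_cong_1_mod_3: "card {j \<in> {0..<n}. j mod 3 = 1} = (n + 1) div 3" for n :: nat
proof (induction n)
  case 0
  show ?case by simp
next
  case (Suc n)
  have "{j \<in> {0..<Suc n}. j mod 3 = 1} =
      (if n mod 3 = 1 then insert n {j \<in> {0..<n}. j mod 3 = 1} else {j \<in> {0..<n}. j mod 3 = 1})"
    by (auto simp: less_Suc_eq)
  then have "card {j \<in> {0..<Suc n}. j mod 3 = 1} = (n + 1) div 3 + of_bool (n mod 3 = 1)"
    using Suc by simp
  also have "\<dots> = (Suc n + 1) div 3"
    by (cases "n mod 3 = 1") (simp; presburger)+
  finally show ?case .
qed

lemma weight_checkerboard:
  assumes m: "m \<ge> 3"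
  shows "weight (prism m) (checkerboard m) = m + (m + 1) div 3 + of_bool (seam m)"
proof -
  have two: "{0..<2} = {0, 1::nat}" by auto
  \<comment> \<open>Each column has one even and one odd vertex; the even one contributes 1 or 2,
    the odd one only the correction at the seam.\<close>
  have col: "checkerboard m (0, j) + checkerboard m (1, j) =
      1 + of_bool (j mod 3 = 1) + of_bool (j = m - 1 \<and> seam m)" for j
    by (cases "even j") (auto simp: checkerboard_def)
  have "weight (prism m) (checkerboard m) =
      (\<Sum>i\<in>{0..<2}. \<Sum>j\<in>{0..<m}. checkerboard m (i, j))"
    unfolding weight_def verts_path_cycle by (simp add: sum.cartesian_product)
  also have "\<dots> = (\<Sum>j\<in>{0..<m}. checkerboard m (0, j) + checkerboard m (1, j))"
    unfolding two by (simp add: sum.distrib)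
  also have "\<dots> = m + (\<Sum>j\<in>{0..<m}. of_bool (j mod 3 = 1)) +
      (\<Sum>j\<in>{0..<m}. of_bool (j = m - 1 \<and> seam m))"
    unfolding col sum.distrib by simp
  also have "(\<Sum>j\<in>{0..<m}. of_bool (j mod 3 = 1)) = (m + 1) div 3"
    unfolding card_cong_1_mod_3[symmetric] by (simp add: of_bool_def sum.If_cases Int_def)
  also have "(\<Sum>j\<in>{0..<m}. of_bool (j = m - 1 \<and> seam m)) = (of_bool (seam m) :: nat)"
    using m by (cases "seam m") (simp_all add: of_bool_def)
  finally show ?thesis .
qed

section \<open>Matching the bounds modulo 6\<close>

lemma ceiling_four_thirds: "\<lceil>4 * real m / 3\<rceil> = int ((4 * m + 2) div 3)"
proof -
  have "3 * ((4 * m + 2) div 3) \<ge> 4 * m" "3 * ((4 * m + 2) div 3) < 4 * m + 3"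
    by presburger+
  then have "3 * real ((4 * m + 2) div 3) \<ge> 4 * real m"
    "3 * real ((4 * m + 2) div 3) < 4 * real m + 3"
    by linarith+
  then show ?thesis
    by (intro ceiling_unique) simp_all
qed

theorem theorem2:
  fixes m :: nat
  assumes "m \<ge> 3"
  shows "int (\<gamma>\<^sub>o\<^sub>i\<^sub>R (path_graph 2 \<box> cycle_graph m)) =
    (if m mod 6 = 3 \<or> m mod 6 = 5
     then \<lceil>4 * real m / 3\<rceil> + 1
     else \<lceil>4 * real m / 3\<rceil>)"
proof -
  define g where "g = \<gamma>\<^sub>o\<^sub>i\<^sub>R (prism m)"
  define q where "q = m div 6"
  have upper: "g \<le> m + (m + 1) div 3 + of_bool (seam m)"
    unfolding g_def
    using oiR_domination_number_le[OF oirdf_checkerboard] weight_checkerboard assms by metis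
  have lower: "3 * g \<ge> 4 * m + (if odd m then 2 else 0)"
    unfolding g_def
    using oiR_domination_number_attained[of "prism m"] weight_lower_bound assms by metis
  have q: "m = 6 * q + m mod 6" by (simp add: q_def)
  have mod3: "m mod 3 = m mod 6 mod 3" and mod2: "even m \<longleftrightarrow> even (m mod 6)"
    by (simp_all add: mod_mod_cancel dvd_mod_iff)
  have "m mod 6 < 6" by simp
  then consider "m mod 6 = 0" | "m mod 6 = 1" | "m mod 6 = 2" | "m mod 6 = 3"
    | "m mod 6 = 4" | "m mod 6 = 5"
    by linarith
  \<comment> \<open>The extra 2 in the lower bound for odd \<open>m\<close> raises the rounded value
    at residues 3 and 5. At residue 1 it does not, since \<open>4 * m + 2\<close> is then the next
    multiple of 3.\<close>
  then have "g = (4 * m + 2) div 3 + (if m mod 6 = 3 \<or> m mod 6 = 5 then 1 else 0)"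
  proof cases
    case 4
    have "(14 + 24 * q) div 3 = 8 * q + 4" "(4 + 6 * q) div 3 = 2 * q + 1" by linarith+
    with 4 show ?thesis
      using upper lower q unfolding seam_def mod3 mod2 by simp
  next
    case 6
    have "(22 + 24 * q) div 3 = 8 * q + 7" by linarith
    with 6 show ?thesis
      using upper lower q unfolding seam_def mod3 mod2 by simp
  qed (use upper lower q in \<open>simp_all add: seam_def mod3 mod2\<close>)
  then show ?thesis
    by (simp add: ceiling_four_thirds g_def)
qed

end
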